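(* Let $\nu>-1$, $t>0$, $0<\lambda<1$, $n\ge0$, and let $P_n(x;t,\lambda)$ be the orthonormal polynomials with respect to the weight $\omega_k=\rho_{k+\nu+1}(t)\lambda^k/k!$, $k\in\mathbb{N}_0$, with three-term recurrence coefficients $A_n,B_n$. Then $$\lambda\frac{\partial P_n}{\partial\lambda}(x;t,\lambda)+A_nP_{n-1}(x;t,\lambda)=-\frac{B_n}{2}P_n(x;t,\lambda).$$
   Context: For $t>0$ and real $\mu$, $\rho_\mu(t)=2t^{\mu/2}K_\mu(2\sqrt t)$, where $K_\mu$ is the modified Bessel (Macdonald) function; for $\mu>0$, $\rho_\mu(t)=\int_0^\infty e^{-t/x-x}x^{\mu-1}dx$. The polynomials $P_n(x;t,\lambda)=a_nx^n+b_nx^{n-1}+\dots$ have real coefficients depending on $t,\lambda$ (and $\nu$), $\deg P_n=n$, and satisfy $\sum_{k=0}^\infty P_n(k;t,\lambda)P_m(k;t,\lambda)\,\omega_k=\delta_{n,m}$ for all $n,m\in\mathbb{N}_0$. They satisfy $xP_n=A_{n+1}P_{n+1}+B_nP_n+A_nP_{n-1}$ with $A_n=a_{n-1}/a_n$, $B_n=b_n/a_n-b_{n+1}/a_{n+1}$; conventions: $P_{-1}\equiv0$, $A_0=0$, $b_0=0$. Standing assumption: the coefficients of the $P_n$ are $C^1$ functions of $(t,\lambda)$ for $t>0$, $0<\lambda<1$. *)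

theory Defs
  imports "HOL-Analysis.Analysis" "HOL-Computational_Algebra.Polynomial"
begin

text \<open>Macdonald function of real order and positive argument, by its standard integral
  representation (DLMF 10.32.9).  The integral converges absolutely for all \<open>z > 0\<close> and all
  real orders, integer orders included.\<close>

definition bessel_K :: "real \<Rightarrow> real \<Rightarrow> real" where
  "bessel_K \<mu> z = (LBINT u:{0..}. exp (- z * cosh u) * cosh (\<mu> * u))"

definition macdonald_rho :: "real \<Rightarrow> real \<Rightarrow> real" where
  "macdonald_rho \<mu> t = 2 * t powr (\<mu> / 2) * bessel_K \<mu> (2 * sqrt t)"

definition weight :: "real \<Rightarrow> real \<Rightarrow> real \<Rightarrow> nat \<Rightarrow> real" where
  "weight \<nu> t l k = macdonald_rho (real k + \<nu> + 1) t * l ^ k / fact k"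

text \<open>The sign of the leading coefficient is not normalised.\<close>

definition orthonormal_polys :: "(nat \<Rightarrow> real) \<Rightarrow> (nat \<Rightarrow> real poly) \<Rightarrow> bool" where
  "orthonormal_polys w p \<longleftrightarrow>
     (\<forall>n. degree (p n) = n) \<and>
     (\<forall>n m. (\<lambda>k. poly (p n) (real k) * poly (p m) (real k) * w k) sums (if n = m then 1 else 0))"

definition lead_a :: "(nat \<Rightarrow> real poly) \<Rightarrow> nat \<Rightarrow> real" where
  "lead_a p n = coeff (p n) n"

definition sublead_b :: "(nat \<Rightarrow> real poly) \<Rightarrow> nat \<Rightarrow> real" where
  "sublead_b p n = (if n = 0 then 0 else coeff (p n) (n - 1))"

text \<open>The coefficients in
  \<open>x p\<^sub>n = A\<^sub>n\<^sub>+\<^sub>1 p\<^sub>n\<^sub>+\<^sub>1 + B\<^sub>n p\<^sub>n + A\<^sub>n p\<^sub>n\<^sub>-\<^sub>1\<close>, with \<open>A\<^sub>0 = 0\<close>.\<close>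

definition rec_A :: "(nat \<Rightarrow> real poly) \<Rightarrow> nat \<Rightarrow> real" where
  "rec_A p n = (if n = 0 then 0 else lead_a p (n - 1) / lead_a p n)"

definition rec_B :: "(nat \<Rightarrow> real poly) \<Rightarrow> nat \<Rightarrow> real" where
  "rec_B p n = sublead_b p n / lead_a p n - sublead_b p (n + 1) / lead_a p (n + 1)"

text \<open>\<open>p\<^sub>n\<^sub>-\<^sub>1\<close>, with \<open>p\<^sub>-\<^sub>1 = 0\<close>.\<close>

definition prev_poly :: "(nat \<Rightarrow> real poly) \<Rightarrow> nat \<Rightarrow> real poly" where
  "prev_poly p n = (if n = 0 then 0 else p (n - 1))"

text \<open>Meant for open \<open>S\<close>.\<close>

definition C1_on :: "('a::real_normed_vector \<Rightarrow> 'b::real_normed_vector) \<Rightarrow> 'a set \<Rightarrow> bool" where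
  "C1_on f S \<longleftrightarrow>
     (\<exists>f' :: 'a \<Rightarrow> 'a \<Rightarrow>\<^sub>L 'b.
        (\<forall>x\<in>S. (f has_derivative blinfun_apply (f' x)) (at x)) \<and> continuous_on S f')"

end

theory Submission
  imports Defs
begin

text \<open>
  For a weight \<open>w\<close> on the natural numbers let \<open>E\<^sub>w q = (\<Sum>k. q k * w k)\<close>.  As a function of the
  parameter \<open>s = \<lambda>\<close> the Macdonald weight has the form \<open>w\<^sub>s k = c k * s ^ k\<close>.  So \<open>E\<close> of a fixed
  polynomial is a power series in \<open>s\<close>, hence
  \<open>s * (d/ds) (E q) = E (X * q)\<close> (\<open>mean_has_derivative\<close>).

  Write \<open>D\<close> for \<open>d/ds\<close> acting on coefficients.  Differentiating \<open>E (P\<^sub>n * P\<^sub>m) = \<delta>\<^sub>n\<^sub>m\<close> gives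
  \<open>E (s * D P\<^sub>n * P\<^sub>m) + E (P\<^sub>n * s * D P\<^sub>m) + E (X * P\<^sub>n * P\<^sub>m) = 0\<close> (\<open>orthonormality_derivative\<close>).
  For \<open>m < n\<close> the middle term vanishes because \<open>D P\<^sub>m\<close> has degree at most \<open>m\<close>, while the last term
  is \<open>A\<^sub>n\<close> if \<open>m = n - 1\<close> and zero for smaller \<open>m\<close>.  For \<open>m = n\<close> the first two terms agree and the
  last is \<open>B\<^sub>n\<close>.  Thus \<open>s * D P\<^sub>n\<close>, of degree at most \<open>n\<close>, has against \<open>P\<^sub>0, \<dots>, P\<^sub>n\<close> the same
  products as \<open>- A\<^sub>n P\<^sub>n\<^sub>-\<^sub>1 - (B\<^sub>n / 2) P\<^sub>n\<close>, and a polynomial of degree at most \<open>n\<close> is determined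
  by these products (\<open>orthonormal_unique\<close>).
\<close>

section \<open>Orthonormal polynomials on the natural numbers\<close>

definition mean :: "(nat \<Rightarrow> real) \<Rightarrow> real poly \<Rightarrow> real" where
  "mean w q = (\<Sum>k. poly q (real k) * w k)"

lemma orthonormal_nonzero:
  assumes "orthonormal_polys w p"
  shows "p n \<noteq> 0"
proof
  assume "p n = 0"
  moreover have "(\<lambda>k. poly (p n) (real k) * poly (p n) (real k) * w k) sums (if n = n then 1 else 0)"
    using assms unfolding orthonormal_polys_def by blast
  ultimately have "(\<lambda>k. 0 :: real) sums 1" by simp
  from sums_unique2[OF sums_zero this] show False by simp
qed

lemma orthonormal_degree:
  "orthonormal_polys w p \<Longrightarrow> degree (p n) = n"
  by (simp add: orthonormal_polys_def)

lemma lead_a_nonzero: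
  "orthonormal_polys w p \<Longrightarrow> lead_a p n \<noteq> 0"
  unfolding lead_a_def
  by (metis leading_coeff_0_iff orthonormal_degree orthonormal_nonzero)

lemma orthonormal_expansion:
  assumes "orthonormal_polys w p" "degree q \<le> n"
  shows "\<exists>c. q = (\<Sum>k\<le>n. smult (c k) (p k))"
  using assms(2)
proof (induction n arbitrary: q)
  case 0
  obtain a where a: "q = [:a:]" using 0 by (metis degree_eq_zeroE le_zero_eq)
  obtain b where b: "p 0 = [:b:]" using orthonormal_degree[OF assms(1), of 0] degree_eq_zeroE by blast
  have "b \<noteq> 0" using orthonormal_nonzero[OF assms(1), of 0] b by auto
  then show ?case using a b by (intro exI[of _ "\<lambda>_. a / b"]) simp
next
  case (Suc n)
  define r where "r = coeff q (Suc n) / lead_a p (Suc n)"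
  have la: "lead_a p (Suc n) \<noteq> 0" using lead_a_nonzero[OF assms(1)] .
  have "degree (q - smult r (p (Suc n))) \<le> n"
  proof (rule degree_le, intro allI impI)
    fix i assume "n < i"
    show "coeff (q - smult r (p (Suc n))) i = 0"
    proof (cases "i = Suc n")
      case True
      then show ?thesis using la by (simp add: r_def lead_a_def)
    next
      case False
      then have "i > Suc n" using \<open>n < i\<close> by simp
      then show ?thesis
        using Suc.prems orthonormal_degree[OF assms(1), of "Suc n"] by (simp add: coeff_eq_0)
    qed
  qed
  then obtain c where c: "q - smult r (p (Suc n)) = (\<Sum>k\<le>n. smult (c k) (p k))"
    using Suc.IH by blast
  have "(\<Sum>k\<le>Suc n. smult ((c(Suc n := r)) k) (p k)) = (\<Sum>k\<le>n. smult (c k) (p k)) + smult r (p (Suc n))"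
    by simp
  also have "\<dots> = q" by (simp only: c[symmetric] diff_add_cancel)
  finally have "q = (\<Sum>k\<le>Suc n. smult ((c(Suc n := r)) k) (p k))" by (rule sym)
  then show ?case by blast
qed

text \<open>\<open>p 0\<close> is a nonzero constant, so orthogonality of \<open>p n\<close> to it already contains the
  convergence of \<open>E (p n)\<close>; the \<open>p n\<close> span all polynomials.\<close>

lemma orthonormal_summable:
  assumes "orthonormal_polys w p"
  shows "summable (\<lambda>k. poly q (real k) * w k)"
proof -
  obtain b where b: "p 0 = [:b:]" using orthonormal_degree[OF assms(1), of 0] degree_eq_zeroE by blast
  have b0: "b \<noteq> 0" using orthonormal_nonzero[OF assms(1), of 0] b by auto
  have base: "summable (\<lambda>k. poly (p n) (real k) * w k)" for n
  proof -
    have "summable (\<lambda>k. poly (p n) (real k) * poly (p 0) (real k) * w k)"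
      using assms unfolding orthonormal_polys_def by (metis sums_summable)
    then have "summable (\<lambda>k. inverse b * (poly (p n) (real k) * poly (p 0) (real k) * w k))"
      by (rule summable_mult)
    then show ?thesis using b b0 by (simp add: field_simps)
  qed
  obtain c where c: "q = (\<Sum>k\<le>degree q. smult (c k) (p k))"
    using orthonormal_expansion[OF assms order_refl] by blast
  have "summable (\<lambda>k. \<Sum>j\<le>degree q. c j * (poly (p j) (real k) * w k))"
    by (intro summable_sum summable_mult base)
  also have "(\<lambda>k. \<Sum>j\<le>degree q. c j * (poly (p j) (real k) * w k)) = (\<lambda>k. poly q (real k) * w k)"
  proof
    fix k
    show "(\<Sum>j\<le>degree q. c j * (poly (p j) (real k) * w k)) = poly q (real k) * w k"
      using arg_cong[OF c, of "\<lambda>q. poly q (real k) * w k"]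
      by (simp only: poly_sum poly_smult sum_distrib_right mult.assoc)
  qed
  finally show ?thesis .
qed

context
  fixes w p
  assumes orthonormal: "orthonormal_polys w p"
begin

lemma mean_add: "mean w (q + r) = mean w q + mean w r"
  unfolding mean_def
  using suminf_add[OF orthonormal_summable[OF orthonormal, of q] orthonormal_summable[OF orthonormal, of r]]
  by (simp add: algebra_simps)

lemma mean_smult: "mean w (smult a q) = a * mean w q"
  unfolding mean_def
  using suminf_mult[OF orthonormal_summable[OF orthonormal, of q], of a]
  by (simp add: mult.assoc)

lemma mean_0: "mean w 0 = 0"
  by (simp add: mean_def)

lemma mean_diff: "mean w (q - r) = mean w q - mean w r"
  using mean_add[of "q - r" r] by simp

lemma mean_sum: "mean w (\<Sum>i\<in>I. f i) = (\<Sum>i\<in>I. mean w (f i))"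
  by (induction I rule: infinite_finite_induct) (simp_all add: mean_0 mean_add)

lemma mean_orthonormal: "mean w (p n * p m) = (if n = m then 1 else 0)"
proof -
  have "(\<lambda>k. poly (p n * p m) (real k) * w k) sums (if n = m then 1 else 0)"
    using orthonormal unfolding orthonormal_polys_def poly_mult by blast
  then show ?thesis unfolding mean_def by (rule sums_unique[symmetric])
qed

lemma mean_lower_degree:
  assumes "degree q < n"
  shows "mean w (p n * q) = 0"
proof -
  obtain c where c: "q = (\<Sum>k\<le>degree q. smult (c k) (p k))"
    using orthonormal_expansion[OF orthonormal order_refl] by blast
  have "mean w (p n * q) = (\<Sum>k\<le>degree q. c k * mean w (p n * p k))"
    by (subst c) (simp add: sum_distrib_left mean_sum mean_smult)
  also have "\<dots> = 0" using assms by (intro sum.neutral) (auto simp: mean_orthonormal)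
  finally show ?thesis .
qed

lemma orthonormal_unique:
  assumes "degree q \<le> n" and prod: "\<And>m. m \<le> n \<Longrightarrow> mean w (q * p m) = 0"
  shows "q = 0"
proof -
  obtain c where c: "q = (\<Sum>k\<le>n. smult (c k) (p k))"
    using orthonormal_expansion[OF orthonormal assms(1)] by blast
  have "c m = 0" if "m \<le> n" for m
  proof -
    have "0 = mean w ((\<Sum>k\<le>n. smult (c k) (p k)) * p m)" using prod[OF that] c by simp
    also have "\<dots> = (\<Sum>k\<le>n. c k * mean w (p k * p m))"
      by (simp add: sum_distrib_right mean_sum mean_smult)
    also have "\<dots> = (\<Sum>k\<le>n. if k = m then c k else 0)"
      by (intro sum.cong) (auto simp: mean_orthonormal)
    also have "\<dots> = c m" using that by simp
    finally show ?thesis by simp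
  qed
  then show ?thesis using c by simp
qed

text \<open>Products with \<open>p n\<close> see only the part of degree \<open>n\<close> of a polynomial of degree at most \<open>n\<close>.\<close>

lemma mean_leading:
  assumes "degree q \<le> n"
  shows "mean w (p n * q) = coeff q n / lead_a p n"
proof -
  define r where "r = coeff q n / lead_a p n"
  have la: "lead_a p n \<noteq> 0" using lead_a_nonzero[OF orthonormal] .
  have z: "coeff (q - smult r (p n)) i = 0" if "i \<ge> n" for i
    using that assms la orthonormal_degree[OF orthonormal, of n]
    by (cases "i = n") (auto simp: r_def lead_a_def coeff_eq_0)
  have "mean w (p n * (q - smult r (p n))) = 0"
  proof (cases "n = 0")
    case True
    then have "q - smult r (p n) = 0" using z by (intro poly_eqI) simp
    then show ?thesis by (simp add: mean_0)
  next
    case False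
    then have "degree (q - smult r (p n)) < n"
      using z degree_lessI by blast
    then show ?thesis by (rule mean_lower_degree)
  qed
  then show ?thesis
    by (simp add: right_diff_distrib mean_diff mean_smult mean_orthonormal r_def)
qed

lemma mean_times_X_previous:
  assumes "n > 0"
  shows "mean w (p n * pCons 0 (p (n - 1))) = rec_A p n"
proof -
  have "degree (pCons 0 (p (n - 1))) \<le> n"
    using assms orthonormal_degree[OF orthonormal, of "n - 1"]
    by (metis One_nat_def Suc_pred degree_pCons_le)
  then have "mean w (p n * pCons 0 (p (n - 1))) = coeff (pCons 0 (p (n - 1))) n / lead_a p n"
    by (rule mean_leading)
  then show ?thesis using assms by (cases n) (simp_all add: rec_A_def lead_a_def)
qed

text \<open>Removing from \<open>X * p n\<close> its component along \<open>p (n + 1)\<close>, which is orthogonal to \<open>p n\<close>,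
  leaves degree at most \<open>n\<close>.\<close>

lemma mean_times_X_diagonal: "mean w (p n * pCons 0 (p n)) = rec_B p n"
proof -
  define r where "r = lead_a p n / lead_a p (Suc n)"
  define q where "q = pCons 0 (p n) - smult r (p (Suc n))"
  have la: "lead_a p n \<noteq> 0" "lead_a p (Suc n) \<noteq> 0" using lead_a_nonzero[OF orthonormal] by auto
  have "degree q \<le> n"
  proof (rule degree_le, intro allI impI)
    fix i assume "n < i"
    then obtain j where j: "i = Suc j" "j \<ge> n" by (metis Suc_le_D less_eq_Suc_le less_Suc_eq_le)
    show "coeff q i = 0"
    proof (cases "j = n")
      case True
      then show ?thesis using j la by (simp add: q_def r_def lead_a_def)
    next
      case False
      then show ?thesis using j orthonormal_degree[OF orthonormal]
        by (simp add: q_def coeff_eq_0)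
    qed
  qed
  then have "mean w (p n * q) = coeff q n / lead_a p n" by (rule mean_leading)
  also have "\<dots> = rec_B p n"
    using la by (cases n) (simp_all add: q_def r_def rec_B_def sublead_b_def lead_a_def field_simps)
  also have "mean w (p n * q) = mean w (p n * pCons 0 (p n))"
    by (simp add: q_def right_diff_distrib mean_diff mean_smult mean_orthonormal del: mult_pCons_right)
  finally show ?thesis .
qed

end

section \<open>Differentiation in the parameter\<close>

text \<open>Summability on all of \<open>(0, 1)\<close>, not just at \<open>s\<close>, is what puts \<open>s\<close> inside the disc of
  convergence.\<close>

lemma mean_has_derivative:
  assumes summable: "\<And>s q. 0 < s \<Longrightarrow> s < 1 \<Longrightarrow> summable (\<lambda>k. poly q (real k) * (c k * s ^ k))"
    and s: "0 < s" "s < 1"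
  shows "((\<lambda>s. mean (\<lambda>k. c k * s ^ k) q) has_real_derivative
           mean (\<lambda>k. c k * s ^ k) (pCons 0 q) / s) (at s)"
proof -
  define d where "d k = poly q (real k) * c k" for k
  define K where "K = (1 + s) / 2"
  have K: "0 < K" "K < 1" "s < K" using s by (auto simp: K_def)
  have sK: "summable (\<lambda>k. d k * K ^ k)"
    using summable[OF K(1,2), of q] by (simp add: d_def mult.assoc)
  have der: "((\<lambda>s. \<Sum>k. d k * s ^ k) has_real_derivative (\<Sum>k. diffs d k * s ^ k)) (at s)"
    using termdiffs_strong[OF sK] K s by simp
  have "summable (\<lambda>k. diffs d k * s ^ k)"
  proof (rule termdiff_converges[of s K])
    show "norm s < K" using K s by simp
    fix x :: real assume "norm x < K"
    then show "summable (\<lambda>n. d n * x ^ n)" using powser_inside[OF sK, of x] K by simp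
  qed
  then have "(\<lambda>k. of_nat k * d k * s ^ (k - Suc 0)) sums (\<Sum>k. diffs d k * s ^ k)"
    by (rule diffs_equiv)
  then have "(\<lambda>k. s * (of_nat k * d k * s ^ (k - Suc 0))) sums (s * (\<Sum>k. diffs d k * s ^ k))"
    by (rule sums_mult)
  also have "(\<lambda>k. s * (of_nat k * d k * s ^ (k - Suc 0))) = (\<lambda>k. poly (pCons 0 q) (real k) * (c k * s ^ k))"
  proof
    fix k show "s * (of_nat k * d k * s ^ (k - Suc 0)) = poly (pCons 0 q) (real k) * (c k * s ^ k)"
      by (cases k) (simp_all add: d_def algebra_simps)
  qed
  finally have "mean (\<lambda>k. c k * s ^ k) (pCons 0 q) = s * (\<Sum>k. diffs d k * s ^ k)"
    unfolding mean_def by (simp add: sums_iff)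
  then show ?thesis using der s by (simp add: mean_def d_def mult.assoc)
qed

definition poly_has_derivative :: "(real \<Rightarrow> real poly) \<Rightarrow> real poly \<Rightarrow> real \<Rightarrow> bool" where
  "poly_has_derivative Q Q' s \<longleftrightarrow>
     (\<forall>i. ((\<lambda>s. coeff (Q s) i) has_real_derivative coeff Q' i) (at s))"

lemma poly_has_derivative_mult:
  assumes "poly_has_derivative Q Q' s" "poly_has_derivative R R' s"
  shows "poly_has_derivative (\<lambda>s. Q s * R s) (Q' * R s + Q s * R') s"
  unfolding poly_has_derivative_def coeff_mult coeff_add sum.distrib[symmetric]
  using assms unfolding poly_has_derivative_def
  by (auto intro!: derivative_eq_intros sum.cong)

lemma poly_eq_sum_bounded:
  fixes q :: "real poly"
  assumes "degree q \<le> N"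
  shows "q = (\<Sum>i\<le>N. smult (coeff q i) (monom 1 i))"
  by (subst poly_as_sum_of_monoms'[OF assms, symmetric]) (simp add: smult_monom)

lemma poly_eval_bounded:
  fixes q :: "real poly"
  assumes "degree q \<le> N"
  shows "poly q x = (\<Sum>i\<le>N. coeff q i * x ^ i)"
  by (subst poly_eq_sum_bounded[OF assms]) (simp add: poly_sum poly_monom)

lemma derivative_degree_le:
  assumes "poly_has_derivative Q Q' s" "open S" "s \<in> S" "\<And>r. r \<in> S \<Longrightarrow> degree (Q r) \<le> N"
  shows "degree Q' \<le> N"
proof (rule degree_le, intro allI impI)
  fix i assume "N < i"
  have "((\<lambda>s. coeff (Q s) i) has_real_derivative coeff Q' i) (at s)"
    using assms(1) by (simp add: poly_has_derivative_def)
  then have "((\<lambda>s. 0) has_real_derivative coeff Q' i) (at s)"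
    by (rule has_field_derivative_transform_within_open[OF _ assms(2,3)])
       (use assms(4) \<open>N < i\<close> in \<open>auto intro!: coeff_eq_0 intro: le_less_trans\<close>)
  then show "coeff Q' i = 0" by (rule DERIV_unique) (rule DERIV_const)
qed

lemma poly_has_derivative_eval:
  assumes "poly_has_derivative Q Q' s" "open S" "s \<in> S" "\<And>r. r \<in> S \<Longrightarrow> degree (Q r) \<le> N"
  shows "((\<lambda>s. poly (Q s) x) has_real_derivative poly Q' x) (at s)"
proof -
  have deg: "degree Q' \<le> N" by (rule derivative_degree_le[OF assms])
  have "((\<lambda>s. \<Sum>i\<le>N. coeff (Q s) i * x ^ i) has_real_derivative (\<Sum>i\<le>N. coeff Q' i * x ^ i)) (at s)"
    using assms(1) unfolding poly_has_derivative_def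
    by (auto intro!: derivative_eq_intros sum.cong)
  then have "((\<lambda>s. \<Sum>i\<le>N. coeff (Q s) i * x ^ i) has_real_derivative poly Q' x) (at s)"
    by (simp add: poly_eval_bounded[OF deg])
  then show ?thesis
    by (rule has_field_derivative_transform_within_open[OF _ assms(2,3)])
       (simp add: poly_eval_bounded[OF assms(4)])
qed

context
  fixes c :: "nat \<Rightarrow> real" and P :: "nat \<Rightarrow> real \<Rightarrow> real poly"
  assumes orth: "\<And>s. 0 < s \<Longrightarrow> s < 1 \<Longrightarrow> orthonormal_polys (\<lambda>k. c k * s ^ k) (\<lambda>n. P n s)"
begin

text \<open>The product rule when the weight and the polynomial both move.  The degree bound, uniform
  in the parameter, writes the mean as a fixed finite combination of moments.\<close>

lemma mean_moving_has_derivative: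
  assumes Q: "poly_has_derivative Q Q' s" and s: "0 < s" "s < 1"
    and deg: "\<And>r. 0 < r \<Longrightarrow> r < 1 \<Longrightarrow> degree (Q r) \<le> N"
  shows "((\<lambda>s. mean (\<lambda>k. c k * s ^ k) (Q s)) has_real_derivative
           mean (\<lambda>k. c k * s ^ k) Q' + mean (\<lambda>k. c k * s ^ k) (pCons 0 (Q s)) / s) (at s)"
proof -
  let ?E = "\<lambda>s. mean (\<lambda>k. c k * s ^ k)"
  have deg': "degree Q' \<le> N"
    by (rule derivative_degree_le[OF Q, of "{0<..<1}"]) (use s deg in auto)
  have expand: "?E r q = (\<Sum>i\<le>N. coeff q i * ?E r (monom 1 i))"
    if "0 < r" "r < 1" "degree q \<le> N" for r q
    by (subst poly_eq_sum_bounded[OF that(3)])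
       (simp only: mean_sum[OF orth[OF that(1,2)]] mean_smult[OF orth[OF that(1,2)]])
  have expandX: "?E s (pCons 0 (Q s)) = (\<Sum>i\<le>N. coeff (Q s) i * ?E s (pCons 0 (monom 1 i)))"
  proof -
    have "pCons 0 (Q s) = (\<Sum>i\<le>N. smult (coeff (Q s) i) (pCons 0 (monom 1 i)))"
    proof -
      have "pCons 0 (Q s) = [:0, 1:] * (\<Sum>i\<le>N. smult (coeff (Q s) i) (monom 1 i))"
        by (subst poly_eq_sum_bounded[OF deg[OF s]]) simp
      then show ?thesis by (simp add: sum_distrib_left)
    qed
    then show ?thesis
      by (simp only: mean_sum[OF orth[OF s]] mean_smult[OF orth[OF s]])
  qed
  have mono: "((\<lambda>s. ?E s (monom 1 i)) has_real_derivative ?E s (pCons 0 (monom 1 i)) / s) (at s)" for i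
    by (rule mean_has_derivative[OF _ s]) (rule orthonormal_summable[OF orth])
  have "((\<lambda>s. \<Sum>i\<le>N. coeff (Q s) i * ?E s (monom 1 i)) has_real_derivative
          (\<Sum>i\<le>N. coeff Q' i * ?E s (monom 1 i) + ?E s (pCons 0 (monom 1 i)) / s * coeff (Q s) i)) (at s)"
    by (intro DERIV_sum DERIV_mult mono) (use Q in \<open>simp add: poly_has_derivative_def\<close>)
  also have "(\<Sum>i\<le>N. coeff Q' i * ?E s (monom 1 i) + ?E s (pCons 0 (monom 1 i)) / s * coeff (Q s) i)
      = ?E s Q' + ?E s (pCons 0 (Q s)) / s"
    by (simp add: expand[OF s deg'] expandX sum.distrib sum_divide_distrib mult.commute)
  finally show ?thesis
    by (rule has_field_derivative_transform_within_open[where S = "{0<..<1}"])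
       (use s expand deg in auto)
qed

text \<open>The left-hand side is \<open>s\<close> times the derivative of \<open>E (P n * P m)\<close>, which is constant on
  \<open>(0, 1)\<close>.\<close>

lemma orthonormality_derivative:
  assumes s: "0 < s" "s < 1"
    and Pn: "poly_has_derivative (P n) Pn' s" and Pm: "poly_has_derivative (P m) Pm' s"
  shows "s * mean (\<lambda>k. c k * s ^ k) (Pn' * P m s) + s * mean (\<lambda>k. c k * s ^ k) (P n s * Pm')
         + mean (\<lambda>k. c k * s ^ k) (pCons 0 (P n s * P m s)) = 0"
proof -
  let ?E = "\<lambda>s. mean (\<lambda>k. c k * s ^ k)"
  have "((\<lambda>s. ?E s (P n s * P m s)) has_real_derivative
      ?E s (Pn' * P m s + P n s * Pm') + ?E s (pCons 0 (P n s * P m s)) / s) (at s)"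
  proof (rule mean_moving_has_derivative[OF poly_has_derivative_mult[OF Pn Pm] s])
    fix r :: real assume "0 < r" "r < 1"
    then show "degree (P n r * P m r) \<le> n + m"
      using degree_mult_le[of "P n r" "P m r"] orthonormal_degree[OF orth] by simp
  qed
  then have "((\<lambda>s. if n = m then 1 else 0) has_real_derivative
      ?E s (Pn' * P m s + P n s * Pm') + ?E s (pCons 0 (P n s * P m s)) / s) (at s)"
    by (rule has_field_derivative_transform_within_open[where S = "{0<..<1}"])
       (use s in \<open>auto simp: mean_orthonormal[OF orth]\<close>)
  then have "?E s (Pn' * P m s + P n s * Pm') + ?E s (pCons 0 (P n s * P m s)) / s = 0"
    using DERIV_unique DERIV_const by blast
  then show ?thesis
    using s by (simp add: mean_add[OF orth[OF s]] field_simps)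
qed

text \<open>Every \<open>E (s * P' n * P m)\<close> with \<open>m \<le> n\<close> can be read off from the derivative of
  orthonormality, because \<open>P' m\<close> has degree at most \<open>m\<close>: it is orthogonal to \<open>P n\<close> when
  \<open>m < n\<close>, and for \<open>m = n\<close> both terms containing a derivative are the same.\<close>

lemma lowering_relation:
  assumes s: "0 < s" "s < 1"
    and der: "\<And>m. poly_has_derivative (P m) (P' m) s"
  shows "smult s (P' n) + smult (rec_A (\<lambda>j. P j s) n) (prev_poly (\<lambda>j. P j s) n)
         = smult (- (rec_B (\<lambda>j. P j s) n / 2)) (P n s)"
proof -
  let ?p = "\<lambda>j. P j s" and ?E = "mean (\<lambda>k. c k * s ^ k)"
  note o = orth[OF s]
  have deg: "degree (P' m) \<le> m" for m
    by (rule derivative_degree_le[OF der, of "{0<..<1}"])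
       (use s orthonormal_degree[OF orth] in auto)
  have X: "pCons 0 (P n s * P m s) = P n s * pCons 0 (P m s)" for m
    by simp
  have prev: "?E (prev_poly ?p n * P m s) = (if n > 0 \<and> m = n - 1 then 1 else 0)" for m
    by (auto simp: prev_poly_def mean_0[OF o] mean_orthonormal[OF o])
  define q where "q = smult s (P' n) + smult (rec_A ?p n) (prev_poly ?p n)
      + smult (rec_B ?p n / 2) (P n s)"
  have "degree q \<le> n"
    unfolding q_def using deg[of n] orthonormal_degree[OF o]
    by (intro degree_add_le) (auto simp: prev_poly_def intro: order_trans[OF degree_smult_le])
  moreover have "?E (q * P m s) = 0" if "m \<le> n" for m
  proof -
    have q: "?E (q * P m s) = s * ?E (P' n * P m s) + rec_A ?p n * ?E (prev_poly ?p n * P m s)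
        + rec_B ?p n / 2 * ?E (P n s * P m s)"
      by (simp add: q_def distrib_right mean_add[OF o] mean_smult[OF o])
    have eq: "s * ?E (P' n * P m s) + s * ?E (P n s * P' m) + ?E (P n s * pCons 0 (P m s)) = 0"
      using orthonormality_derivative[OF s der[of n] der[of m]] unfolding X .
    consider "m = n" | "n > 0" "m = n - 1" | "Suc m < n" using \<open>m \<le> n\<close> by linarith
    then show ?thesis
    proof cases
      case 1
      then have "2 * (s * ?E (P' n * P n s)) + rec_B ?p n = 0"
        using eq mean_times_X_diagonal[OF o, of n] by (simp add: mult.commute del: mult_pCons_right)
      then show ?thesis using q prev[of m] 1 by (auto simp: mean_orthonormal[OF o])
    next
      case 2
      then have "?E (P n s * P' m) = 0"
        using deg[of m] by (intro mean_lower_degree[OF o]) simp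
      then have "s * ?E (P' n * P m s) + rec_A ?p n = 0"
        using eq mean_times_X_previous[OF o, of n] 2 by (simp del: mult_pCons_right)
      then show ?thesis using q prev[of m] 2 by (simp add: mean_orthonormal[OF o] split: if_splits)
    next
      case 3
      have "?E (P n s * P' m) = 0"
        using deg[of m] 3 by (intro mean_lower_degree[OF o]) simp
      moreover have "?E (P n s * pCons 0 (P m s)) = 0"
        by (intro mean_lower_degree[OF o] le_less_trans[OF degree_pCons_le])
           (use 3 orthonormal_degree[OF o] in simp)
      ultimately have "s * ?E (P' n * P m s) = 0" using eq by simp
      then show ?thesis using q prev[of m] 3 by (auto simp: mean_orthonormal[OF o])
    qed
  qed
  ultimately have "q = 0" by (rule orthonormal_unique[OF o])
  then show ?thesis by (simp add: q_def add_eq_0_iff)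
qed

end

section \<open>Smooth families and the Macdonald weight\<close>

lemma C1_on_partial_snd:
  fixes f :: "real \<Rightarrow> real \<Rightarrow> real"
  assumes "C1_on (\<lambda>(t, l). f t l) S" "(t, l) \<in> S"
  shows "\<exists>d. ((\<lambda>s. f t s) has_real_derivative d) (at l)"
proof -
  obtain f' where "\<forall>x\<in>S. ((\<lambda>(t, l). f t l) has_derivative blinfun_apply (f' x)) (at x)"
    using assms(1) unfolding C1_on_def by auto
  then obtain D where "((\<lambda>(t, l). f t l) has_derivative D) (at (t, l))"
    using assms(2) by blast
  then have "((\<lambda>(t, l). f t l) \<circ> (\<lambda>s. (t, s)) has_derivative D \<circ> (\<lambda>h. (0, h))) (at l)"
    by (intro diff_chain_at) (auto intro!: derivative_eq_intros)
  then have "(\<lambda>s. f t s) differentiable (at l)"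
    unfolding differentiable_def o_def by auto
  then show ?thesis by (simp add: real_differentiable_def)
qed

text \<open>The bound on the degrees makes the sequence of the coefficients' derivatives finitely
  supported, so that it is again a polynomial.\<close>

lemma poly_derivative_exists:
  assumes "\<And>i. \<exists>d. ((\<lambda>s. coeff (Q s) i) has_real_derivative d) (at s)"
    and "open S" "s \<in> S" and deg: "\<And>r. r \<in> S \<Longrightarrow> degree (Q r) \<le> N"
  shows "\<exists>Q'. poly_has_derivative Q Q' s"
proof -
  have "\<forall>i. \<exists>d. ((\<lambda>s. coeff (Q s) i) has_real_derivative d) (at s)"
    using assms(1) by blast
  from choice[OF this]
  obtain d where d: "\<And>i. ((\<lambda>s. coeff (Q s) i) has_real_derivative d i) (at s)"
    by blast
  have "((\<lambda>s. coeff (Q s) i) has_real_derivative (if i \<le> N then d i else 0)) (at s)" for i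
  proof (cases "i \<le> N")
    case False
    have "((\<lambda>s. 0) has_real_derivative 0) (at s)" by simp
    then have "((\<lambda>s. coeff (Q s) i) has_real_derivative 0) (at s)"
      by (rule has_field_derivative_transform_within_open[OF _ assms(2,3)])
         (use deg False in \<open>auto intro!: coeff_eq_0 intro: le_less_trans[OF deg]\<close>)
    then show ?thesis using False by simp
  qed (use d in simp)
  moreover have "coeff (\<Sum>i\<le>N. monom (d i) i) i = (if i \<le> N then d i else 0)" for i
    by (simp add: coeff_sum)
  ultimately have "poly_has_derivative Q (\<Sum>i\<le>N. monom (d i) i) s"
    unfolding poly_has_derivative_def by simp
  then show ?thesis by blast
qed

theorem mainTheorem4:
  fixes \<nu> t l x :: real and n :: nat and P :: "nat \<Rightarrow> real \<Rightarrow> real \<Rightarrow> real poly"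
  assumes nu: "\<nu> > -1"
    and orth: "\<And>t l. t > 0 \<Longrightarrow> 0 < l \<Longrightarrow> l < 1 \<Longrightarrow>
                 orthonormal_polys (weight \<nu> t l) (\<lambda>n. P n t l)"
    and smooth: "\<And>n i. C1_on (\<lambda>(t, l). coeff (P n t l) i) ({0<..} \<times> {0<..<1})"
    and t: "t > 0" and l: "0 < l" "l < 1"
  shows "(\<lambda>s. poly (P n t s) x) differentiable (at l) \<and>
         l * deriv (\<lambda>s. poly (P n t s) x) l
           + rec_A (\<lambda>j. P j t l) n * poly (prev_poly (\<lambda>j. P j t l) n) x
         = - (rec_B (\<lambda>j. P j t l) n / 2) * poly (P n t l) x"
proof -
  define c where "c k = macdonald_rho (real k + \<nu> + 1) t / fact k" for k
  have orth': "orthonormal_polys (\<lambda>k. c k * s ^ k) (\<lambda>n. P n t s)" if "0 < s" "s < 1" for s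
  proof -
    have "weight \<nu> t s = (\<lambda>k. c k * s ^ k)" by (rule ext) (simp add: weight_def c_def)
    then show ?thesis using orth[OF t that] by simp
  qed
  have deg: "degree (P m t r) \<le> m" if "r \<in> {0<..<1}" for m r
    using that orthonormal_degree[OF orth'] by simp
  have "\<exists>Q'. poly_has_derivative (P m t) Q' l" for m
  proof (rule poly_derivative_exists[of _ _ "{0<..<1}" m])
    show "\<exists>d. ((\<lambda>s. coeff (P m t s) i) has_real_derivative d) (at l)" for i
      by (rule C1_on_partial_snd[OF smooth]) (use t l in simp)
  qed (use l deg in auto)
  then obtain P' where P': "\<And>m. poly_has_derivative (P m t) (P' m) l" by metis
  have D: "((\<lambda>s. poly (P n t s) x) has_real_derivative poly (P' n) x) (at l)"
    by (rule poly_has_derivative_eval[OF P', of "{0<..<1}" n]) (use l deg in auto)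
  have "smult l (P' n) + smult (rec_A (\<lambda>j. P j t l) n) (prev_poly (\<lambda>j. P j t l) n)
         = smult (- (rec_B (\<lambda>j. P j t l) n / 2)) (P n t l)"
    by (rule lowering_relation[OF orth' l P'])
  from arg_cong[OF this, of "\<lambda>q. poly q x"]
  have "l * poly (P' n) x + rec_A (\<lambda>j. P j t l) n * poly (prev_poly (\<lambda>j. P j t l) n) x
         = - (rec_B (\<lambda>j. P j t l) n / 2) * poly (P n t l) x"
    by simp
  then show ?thesis using D DERIV_imp_deriv[OF D] real_differentiable_def by auto
qed

end
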